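(* Let $n\in \mathbb{N}$ be not prime, let $p \mid n$ be a prime divisor, and let $\gcd(a,n)=1$. Then for any $0<|c| \leq p-1$, $$\left| \sum_{j=1}^{n} \operatorname{sign}\left(\cos\left( \frac{2\pi a j}{n} \right)\right)\operatorname{sign}\left(\cos\left( \frac{2\pi}{n}\left(a+\frac{cn}{p}\right)j\right)\right)\right| = \frac{n}{p^2}+\mathcal{O}(p).$$
   Context: Here $a$ and $c$ are integers, and $\operatorname{sign}(x)=+1$ if $x\ge 0$ and $-1$ otherwise (the choice of value for $\operatorname{sign}(0)$ does not matter). The constant implied by $\mathcal{O}$ is absolute.
   Formalization: The prime p is assumed to be odd: for p = 2 the claim is false, since then c = ±1, the summands are (−1)^j apart from at most two j, and the sum stays bounded while n/4 is unbounded. *)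

theory Defs
  imports Complex_Main "HOL-Computational_Algebra.Primes"
begin

text \<open>
  Unlike the library's \<open>sgn\<close>, \<open>signum\<close> takes the value \<open>1\<close> at \<open>0\<close>.

  The error term \<open>O(p)\<close> is rendered by a single real \<open>C\<close>, chosen before \<open>n\<close>, \<open>p\<close>, \<open>a\<close> and \<open>c\<close>.
  The prime \<open>p = 2\<close> has to be excluded: there \<open>c = 1\<close> or \<open>c = -1\<close>, and
  \<open>cos (x + c * pi * j) = (-1) ^ j * cos x\<close>. So, unless a cosine vanishes, the \<open>j\<close>-th summand is
  \<open>(-1) ^ j\<close>; the sum over \<open>j = 1..n\<close> stays bounded (\<open>n\<close> is even), unlike \<open>n / 4\<close>.
\<close>

definition signum :: "real \<Rightarrow> real" where
  "signum x = (if x \<ge> 0 then 1 else -1)"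

end

theory Submission
  imports Defs "HOL-Number_Theory.Cong"
begin

text \<open>
  Put \<open>m = n / p\<close> and split \<open>j = r + p q\<close>. For fixed \<open>r\<close> the arguments of the first cosine,
  measured in full turns, run over a coset of the multiples of \<open>1 / m\<close>, while the second argument
  differs from the first by the constant \<open>c r / p\<close>. The product of the two signs is a combination of
  indicators of arcs, and an arc of length \<open>l\<close> contains \<open>m l + O(1)\<close> points of such a coset. So each
  \<open>r\<close> contributes \<open>m (1 - 4 \<parallel>c r / p\<parallel>) + O(1)\<close>, with \<open>\<parallel>\<cdot>\<parallel>\<close> the distance to the nearest
  integer, and these main terms add up to \<open>m / p\<close>, because \<open>r \<mapsto> c r\<close> permutes the residues
  modulo \<open>p\<close>.
\<close>

section \<open>Sums over equally spaced points\<close>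

text \<open>Raising \<open>t\<close> by one slides a window of \<open>m\<close> consecutive
  integers: it loses \<open>t div m\<close> and gains \<open>(t + m) div m\<close>, which is one
  more. Induction in both directions starts at \<open>t = 0\<close>, where every quotient
  vanishes.\<close>

lemma sum_div_shift:
  fixes t :: int
  assumes "m > 0"
  shows "(\<Sum>q<m. (t + int q) div int m) = t"
proof -
  have step: "(\<Sum>q<m. (t + 1 + int q) div int m) = (\<Sum>q<m. (t + int q) div int m) + 1" for t
  proof -
    let ?g = "\<lambda>q. (t + int q) div int m"
    have "(\<Sum>q<m. (t + 1 + int q) div int m) = (\<Sum>q<m. ?g (Suc q))"
      by (intro sum.cong) (auto simp: algebra_simps)
    also have "\<dots> = (\<Sum>q<m. ?g q) + (?g m - ?g 0)"
      using sum_lessThan_telescope[of ?g m] by (simp add: sum_subtractf)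
    also have "?g m - ?g 0 = 1"
      using assms by simp
    finally show ?thesis .
  qed
  show ?thesis
  proof (induction t rule: int_induct[where k = 0])
    case base
    then show ?case by (auto intro!: sum.neutral)
  next
    case (step1 i)
    then show ?case using step[of i] by simp
  next
    case (step2 i)
    then show ?case using step[of "i - 1"] by simp
  qed
qed

lemma hermite_identity:
  fixes x :: real
  assumes "m > 0"
  shows "(\<Sum>q<m. \<lfloor>x + real q / real m\<rfloor>) = \<lfloor>real m * x\<rfloor>"
proof -
  have "\<lfloor>x + real q / real m\<rfloor> = (\<lfloor>real m * x\<rfloor> + int q) div int m" for q
  proof -
    have "x + real q / real m = (real m * x + real_of_int (int q)) / real_of_int (int m)"
      using assms by (simp add: field_simps)
    then show ?thesis
      by (simp only: floor_divide_real_eq_div floor_add_int of_nat_0_le_iff)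
  qed
  then show ?thesis
    using sum_div_shift[OF assms] by simp
qed

text \<open>The reflection \<open>q \<mapsto> m - 1 - q\<close> together with
  \<open>\<lceil>z\<rceil> = - \<lfloor>- z\<rfloor>\<close> reduces this to the floor version at
  \<open>?y\<close>.\<close>

lemma hermite_identity_ceiling:
  fixes x :: real
  assumes "m > 0"
  shows "(\<Sum>q<m. \<lceil>x + real q / real m\<rceil>) = \<lceil>real m * x\<rceil> + int m - 1"
proof -
  let ?y = "- x - (real m - 1) / real m"
  have "(\<Sum>q<m. \<lceil>x + real q / real m\<rceil>) = (\<Sum>q<m. \<lceil>x + real (m - Suc q) / real m\<rceil>)"
    by (rule sum.nat_diff_reindex[symmetric])
  also have "\<dots> = (\<Sum>q<m. - \<lfloor>?y + real q / real m\<rfloor>)"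
  proof (intro sum.cong refl)
    fix q assume "q \<in> {..<m}"
    then have "- (x + real (m - Suc q) / real m) = ?y + real q / real m"
      by (simp add: of_nat_diff diff_divide_distrib add_divide_distrib)
    then show "\<lceil>x + real (m - Suc q) / real m\<rceil> = - \<lfloor>?y + real q / real m\<rfloor>"
      by (simp only: ceiling_def)
  qed
  also have "\<dots> = - \<lfloor>real m * ?y\<rfloor>"
    using hermite_identity[OF assms, of ?y] by (simp add: sum_negf)
  also have "real m * ?y = - (real m * x) - real_of_int (int m - 1)"
    using assms by (simp add: field_simps)
  also have "- \<lfloor>\<dots>\<rfloor> = \<lceil>real m * x\<rceil> + int m - 1"
    by (simp only: floor_diff_of_int ceiling_def)
  finally show ?thesis .
qed

text \<open>Multiplication by \<open>a\<close> permutes the residues modulo \<open>m\<close>, and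
  \<open>h\<close> sees its argument only modulo 1. This serves twice: for the points
  \<open>a q / m\<close> and for the lags \<open>c r / p\<close>.\<close>

lemma sum_multiples_periodic:
  fixes h :: "real \<Rightarrow> 'b::comm_monoid_add"
  assumes per: "\<And>x (k::int). h (x + of_int k) = h x"
    and "coprime a (int m)"
  shows "(\<Sum>q<m. h (real_of_int a * real q / real m)) = (\<Sum>q<m. h (real q / real m))"
proof (cases "m = 0")
  case False
  let ?\<pi> = "\<lambda>q. nat (a * int q mod int m)"
  have inj: "inj_on ?\<pi> {..<m}"
  proof (rule inj_onI)
    fix q r assume qr: "q \<in> {..<m}" "r \<in> {..<m}" and "?\<pi> q = ?\<pi> r"
    then have "[a * int q = a * int r] (mod int m)"
      using False by (simp add: cong_def nat_eq_iff)
    then have "[int q = int r] (mod int m)"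
      using assms(2) cong_mult_lcancel by blast
    then show "q = r"
      using qr by (simp add: cong_def)
  qed
  have "?\<pi> ` {..<m} \<subseteq> {..<m}"
    using False by (auto simp: nat_less_iff)
  then have bij: "bij_betw ?\<pi> {..<m} {..<m}"
    using inj by (simp add: bij_betw_def endo_inj_surj)
  have "h (real_of_int a * real q / real m) = h (real (?\<pi> q) / real m)" for q
  proof -
    have "real_of_int a * real q = real_of_int (a * int q)"
      by simp
    also have "a * int q = a * int q mod int m + int m * (a * int q div int m)"
      by simp
    also have "a * int q mod int m = int (?\<pi> q)"
      using False by simp
    finally have "real_of_int a * real q
        = real (?\<pi> q) + real m * of_int (a * int q div int m)"
      by (simp only: of_int_add of_int_mult of_int_of_nat_eq)
    then have "real_of_int a * real q / real m
        = real (?\<pi> q) / real m + of_int (a * int q div int m)"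
      using False by (simp only: add_divide_distrib) simp
    then show ?thesis
      by (simp only: per)
  qed
  then show ?thesis
    using sum.reindex_bij_betw[OF bij, of "\<lambda>q. h (real q / real m)"] by simp
qed simp

section \<open>Arcs and signs of cosines\<close>

text \<open>For \<open>\<alpha> < \<beta> \<le> \<alpha> + 1\<close> this is the indicator of the open arc \<open>(\<alpha>, \<beta>)\<close> modulo 1.\<close>

definition arc :: "real \<Rightarrow> real \<Rightarrow> real \<Rightarrow> int" where
  "arc \<alpha> \<beta> x = \<lceil>x - \<alpha>\<rceil> - \<lfloor>x - \<beta>\<rfloor> - 1"

lemma arc_add_int: "arc \<alpha> \<beta> (x + of_int k) = arc \<alpha> \<beta> x"
proof -
  have "x + of_int k - \<alpha> = (x - \<alpha>) + of_int k" "x + of_int k - \<beta> = (x - \<beta>) + of_int k"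
    by simp_all
  then show ?thesis
    unfolding arc_def by (simp only: ceiling_add_of_int floor_add_int[symmetric])
qed

lemma arc_add: "arc \<alpha> \<beta> (x + y) = arc (\<alpha> - y) (\<beta> - y) x"
  by (simp add: arc_def algebra_simps)

text \<open>Hermite's identities collapse the sum to one ceiling minus one floor minus 1. Each
  rounding adds an error in \<open>[0, 1)\<close>, so the total error lies in
  \<open>[-1, 1)\<close>, whatever the arc.\<close>

lemma sum_arc_bound:
  assumes "m > 0"
  shows "\<bar>real_of_int (\<Sum>q<m. arc \<alpha> \<beta> (x + real q / real m)) - real m * (\<beta> - \<alpha>)\<bar> \<le> 1"
proof -
  have "(\<Sum>q<m. arc \<alpha> \<beta> (x + real q / real m))
      = (\<Sum>q<m. \<lceil>(x - \<alpha>) + real q / real m\<rceil>) - (\<Sum>q<m. \<lfloor>(x - \<beta>) + real q / real m\<rfloor>) - int m"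
    by (simp add: arc_def sum_subtractf diff_add_eq)
  also have "\<dots> = \<lceil>real m * (x - \<alpha>)\<rceil> - \<lfloor>real m * (x - \<beta>)\<rfloor> - 1"
    by (simp only: hermite_identity[OF assms] hermite_identity_ceiling[OF assms])
  finally have *: "(\<Sum>q<m. arc \<alpha> \<beta> (x + real q / real m))
      = \<lceil>real m * (x - \<alpha>)\<rceil> - \<lfloor>real m * (x - \<beta>)\<rfloor> - 1" .
  have "real m * (\<beta> - \<alpha>) = real m * (x - \<alpha>) - real m * (x - \<beta>)"
    by (simp add: algebra_simps)
  then show ?thesis
    unfolding * abs_le_iff using ceiling_correct[of "real m * (x - \<alpha>)"]
      floor_correct[of "real m * (x - \<beta>)"] by simp linarith
qed

text \<open>Two open half circles that differ by a rotation of less than half a turn meet in a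
  single arc. At \<open>\<delta> = 1/2\<close> the formula breaks: the right side is -1 at
  \<open>x = 1/4\<close>.\<close>

lemma arc_Int:
  assumes "0 \<le> \<delta>" "\<delta> < 1/2"
  shows "arc (1/4) (3/4) x * arc (1/4 - \<delta>) (3/4 - \<delta>) x = arc (1/4) (3/4 - \<delta>) x"
proof -
  \<comment> \<open>By periodicity \<open>x\<close> may be moved into \<open>[1/4, 5/4)\<close>,
    where each rounded term takes at most three values.\<close>
  define k where "k = \<lfloor>x - 1/4\<rfloor>"
  define y where "y = x - of_int k"
  have y: "1/4 \<le> y" "y < 5/4"
    unfolding y_def k_def by linarith+
  have "arc (1/4) (3/4) y * arc (1/4 - \<delta>) (3/4 - \<delta>) y = arc (1/4) (3/4 - \<delta>) y"
  proof -
    have c1: "\<lceil>y - 1/4\<rceil> = (if y = 1/4 then 0 else 1)"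
      using y by (auto simp: ceiling_eq_iff)
    have f1: "\<lfloor>y - 3/4\<rfloor> = (if y < 3/4 then -1 else 0)"
      using y by (auto simp: floor_eq_iff)
    \<comment> \<open>The value 2 belongs to the next copy of the translated arc; it forces
      \<open>y > 3/4\<close>, where the first arc is 0.\<close>
    have c2: "\<lceil>y - (1/4 - \<delta>)\<rceil> =
        (if y + \<delta> = 1/4 then 0 else if y + \<delta> \<le> 5/4 then 1 else 2)"
      using y assms by (auto simp: ceiling_eq_iff)
    have f2: "\<lfloor>y - (3/4 - \<delta>)\<rfloor> = (if y + \<delta> < 3/4 then -1 else 0)"
      using y assms by (auto simp: floor_eq_iff)
    show ?thesis
      unfolding arc_def c1 f1 c2 f2 using y assms by auto
  qed
  then show ?thesis
    using arc_add_int[of _ _ y k] by (simp add: y_def)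
qed

lemma cos_turns_add_int: "cos (2 * pi * (x + of_int k)) = cos (2 * pi * x)"
proof -
  have "2 * pi * (x + of_int k) = 2 * pi * x + 2 * of_int k * pi"
    by (simp add: algebra_simps)
  then show ?thesis
    using cos_int_2pin[of k] sin_int_2pin[of k] by (simp add: cos_add mult.commute mult.left_commute)
qed

text \<open>With angles in full turns, the cosine is negative exactly on the open arc from 1/4 to
  3/4. Its zeros are the endpoints, which the arc omits, in accordance with
  \<open>signum 0 = 1\<close>.\<close>

lemma signum_cos_turns: "signum (cos (2 * pi * x)) = 1 - 2 * of_int (arc (1/4) (3/4) x)"
proof -
  define k where "k = \<lfloor>x + 1/4\<rfloor>"
  define y where "y = x - of_int k"
  have y: "-1/4 \<le> y" "y < 3/4"
    unfolding y_def k_def by linarith+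
  have "signum (cos (2 * pi * y)) = 1 - 2 * of_int (arc (1/4) (3/4) y)"
  proof (cases "y \<le> 1/4")
    case True
    have "pi * y \<le> pi * (1/4)" "pi * (-1/4) \<le> pi * y"
      using True y by (intro mult_left_mono; simp)+
    then have "cos (2 * pi * y) \<ge> 0"
      by (intro cos_ge_zero) linarith+
    moreover have "\<lceil>y - 1/4\<rceil> = 0" "\<lfloor>y - 3/4\<rfloor> = -1"
      using True y by (auto simp: ceiling_eq_iff floor_eq_iff)
    ultimately show ?thesis
      by (simp add: signum_def arc_def)
  next
    case False
    have "pi * (1/4) < pi * y" "pi * y < pi * (3/4)"
      using False y by (intro mult_strict_left_mono; simp)+
    then have "cos (2 * pi * y - pi) > 0"
      by (intro cos_gt_zero_pi) linarith+
    moreover have "\<lceil>y - 1/4\<rceil> = 1" "\<lfloor>y - 3/4\<rfloor> = -1"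
      using False y by (auto simp: ceiling_eq_iff floor_eq_iff)
    ultimately show ?thesis
      by (simp add: signum_def arc_def)
  qed
  then show ?thesis
    using arc_add_int[of _ _ y k] cos_turns_add_int[of y k] by (simp add: y_def)
qed

section \<open>Correlation of the cosine's sign with its translate\<close>

definition sign_corr :: "real \<Rightarrow> real \<Rightarrow> real" where
  "sign_corr \<delta> x = signum (cos (2 * pi * x)) * signum (cos (2 * pi * (x + \<delta>)))"

lemma sign_corr_add_int: "sign_corr \<delta> (x + of_int k) = sign_corr \<delta> x"
  using cos_turns_add_int[of x k] cos_turns_add_int[of "x + \<delta>" k]
  by (simp add: sign_corr_def add_ac)

text \<open>Expand \<open>(1 - 2 A) (1 - 2 B) = 1 - 2 A - 2 B + 4 A B\<close> with arc indicators
  \<open>A\<close>, \<open>B\<close>; by \<open>arc_Int\<close> the product \<open>A B\<close> is an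
  arc of length \<open>1/2 - \<delta>\<close>. The main terms give
  \<open>m (1 - 1 - 1 + 4 (1/2 - \<delta>))\<close>, and the errors at most
  \<open>2 + 2 + 4 = 8\<close>.\<close>

lemma sum_sign_corr_bound_small:
  assumes "m > 0" and \<delta>: "0 \<le> \<delta>" "\<delta> < 1/2"
  shows "\<bar>(\<Sum>q<m. sign_corr \<delta> (x + real q / real m)) - real m * (1 - 4 * \<delta>)\<bar> \<le> 8"
proof -
  let ?S = "\<lambda>\<alpha> \<beta>. real_of_int (\<Sum>q<m. arc \<alpha> \<beta> (x + real q / real m))"
  have "sign_corr \<delta> y = 1 - 2 * of_int (arc (1/4) (3/4) y)
      - 2 * of_int (arc (1/4 - \<delta>) (3/4 - \<delta>) y) + 4 * of_int (arc (1/4) (3/4 - \<delta>) y)" for y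
    unfolding sign_corr_def signum_cos_turns arc_add arc_Int[OF \<delta>, symmetric]
    by (simp add: algebra_simps)
  then have "(\<Sum>q<m. sign_corr \<delta> (x + real q / real m))
      = real m - 2 * ?S (1/4) (3/4) - 2 * ?S (1/4 - \<delta>) (3/4 - \<delta>) + 4 * ?S (1/4) (3/4 - \<delta>)"
    by (simp add: sum.distrib sum_subtractf sum_distrib_left)
  moreover note sum_arc_bound[OF assms(1), of "1/4" "3/4" x]
    sum_arc_bound[OF assms(1), of "1/4 - \<delta>" "3/4 - \<delta>" x]
    sum_arc_bound[OF assms(1), of "1/4" "3/4 - \<delta>" x]
  ultimately show ?thesis
    unfolding abs_le_iff by (simp add: algebra_simps)
qed

text \<open>The mean of \<open>sign_corr \<delta>\<close> over a period, that is \<open>1 - 4 \<parallel>\<delta>\<parallel>\<close>.\<close>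

definition mean_corr :: "real \<Rightarrow> real" where
  "mean_corr \<delta> = \<bar>2 - 4 * frac \<delta>\<bar> - 1"

lemma sum_sign_corr_bound:
  assumes "m > 0" and "frac \<delta> \<noteq> 1/2"
  shows "\<bar>(\<Sum>q<m. sign_corr \<delta> (x + real q / real m)) - real m * mean_corr \<delta>\<bar> \<le> 8"
proof (cases "frac \<delta> < 1/2")
  case True
  have "sign_corr \<delta> y = sign_corr (frac \<delta>) y" for y
    using cos_turns_add_int[of "y + frac \<delta>" "\<lfloor>\<delta>\<rfloor>"] by (simp add: sign_corr_def frac_def)
  then show ?thesis
    using sum_sign_corr_bound_small[OF assms(1) frac_ge_0 True, of x] True
    by (simp add: mean_corr_def)
next
  case False
  then have "frac \<delta> > 1/2"
    using assms(2) by simp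
  then have \<epsilon>: "0 \<le> 1 - frac \<delta>" "1 - frac \<delta> < 1/2"
    using frac_lt_1[of \<delta>] by simp_all
  \<comment> \<open>Seen from \<open>\<delta> + y\<close>, the two cosines exchange roles and the
    lag becomes \<open>- \<delta>\<close>, which is \<open>1 - frac \<delta>\<close> modulo
    1.\<close>
  have "sign_corr \<delta> y = sign_corr (1 - frac \<delta>) (\<delta> + y)" for y
    using cos_turns_add_int[of y "1 + \<lfloor>\<delta>\<rfloor>"] by (simp add: sign_corr_def frac_def add_ac)
  then show ?thesis
    using sum_sign_corr_bound_small[OF assms(1) \<epsilon>, of "\<delta> + x"] False
    by (simp add: mean_corr_def add.assoc)
qed

lemma mean_corr_add_int: "mean_corr (\<delta> + of_int k) = mean_corr \<delta>"
  by (simp add: mean_corr_def frac_def)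

text \<open>The absolute values \<open>\<bar>2 p - 4 r\<bar>\<close> add up to
  \<open>p\<^sup>2 + 1\<close> for odd \<open>p\<close>; dividing by \<open>p\<close> and
  subtracting \<open>p\<close> leaves \<open>1 / p\<close>.\<close>

lemma sum_mean_corr:
  assumes "odd p"
  shows "(\<Sum>r<p. mean_corr (real r / real p)) = 1 / real p"
proof -
  obtain h where p: "p = Suc (2 * h)"
    using assms by (auto elim: oddE)
  have fr: "mean_corr (real r / real p) = \<bar>2 * real p - 4 * real r\<bar> / real p - 1" if "r < p" for r
  proof -
    have "frac (real r / real p) = real r / real p"
      using that by (subst frac_eq) auto
    then have "mean_corr (real r / real p) = \<bar>(2 * real p - 4 * real r) / real p\<bar> - 1"
      using that by (simp add: mean_corr_def diff_divide_distrib)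
    then show ?thesis
      by simp
  qed
  have sub: "(\<Sum>r<Suc (2 * h). \<bar>2 * real (Suc (2 * h)) - 4 * real r\<bar>)
      = 1 + (real (Suc (2 * h)))\<^sup>2"
  proof -
    \<comment> \<open>The terms are positive up to \<open>r = h\<close> and negative afterwards. The
      sum of absolute values is thus twice the partial sum at \<open>h + 1\<close> minus the full
      sum: \<open>4 (h + 1)\<^sup>2 - 2 (2 h + 1) = (2 h + 1)\<^sup>2 + 1\<close>.\<close>
    have up: "(\<Sum>r<k. 2 * real (Suc (2 * h)) - 4 * real r) = 2 * real k * real (2 * h + 2 - k)"
      if "k \<le> 2 * h + 2" for k
      using that by (induction k) (auto simp: of_nat_diff algebra_simps)
    let ?t = "\<lambda>r. 2 * real (Suc (2 * h)) - 4 * real r"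
    have split: "(\<Sum>r<Suc (2 * h). f r) = (\<Sum>r<Suc h. f r) + (\<Sum>r\<in>{Suc h..<Suc (2 * h)}. f r)"
      for f :: "nat \<Rightarrow> real"
      using sum.atLeastLessThan_concat[of 0 "Suc h" "Suc (2 * h)" f]
      by (simp only: lessThan_atLeast0)
    have "(\<Sum>r<Suc (2 * h). \<bar>?t r\<bar>) = (\<Sum>r<Suc h. \<bar>?t r\<bar>) + (\<Sum>r\<in>{Suc h..<Suc (2 * h)}. \<bar>?t r\<bar>)"
      by (rule split)
    also have "(\<Sum>r<Suc h. \<bar>?t r\<bar>) = (\<Sum>r<Suc h. ?t r)"
      by (intro sum.cong) auto
    also have "(\<Sum>r\<in>{Suc h..<Suc (2 * h)}. \<bar>?t r\<bar>) = (\<Sum>r\<in>{Suc h..<Suc (2 * h)}. - ?t r)"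
      by (intro sum.cong) auto
    also have "\<dots> = (\<Sum>r<Suc h. ?t r) - (\<Sum>r<Suc (2 * h). ?t r)"
      using split[of ?t] by (simp only: sum_negf)
    finally show ?thesis
      using up[of "Suc h"] up[of "Suc (2 * h)"]
      by (simp add: power2_eq_square algebra_simps)
  qed
  have "(\<Sum>r<p. mean_corr (real r / real p)) = (\<Sum>r<p. \<bar>2 * real p - 4 * real r\<bar>) / real p - real p"
    by (simp add: fr sum_subtractf sum_divide_distrib)
  also have "\<dots> = 1 / real p"
    using sub by (simp add: p field_simps power2_eq_square)
  finally show ?thesis .
qed

section \<open>The correlation sum\<close>

lemma correlation_sum_bound:
  fixes a c :: int
  assumes "m > 0" "odd p" "coprime a (int m)" "coprime c (int p)"
  shows "\<bar>(\<Sum>j<m * p. sign_corr (real_of_int c * real j / real p)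
            (real_of_int a * real j / real (m * p))) - real m / real p\<bar> \<le> 8 * real p"
proof -
  have p: "p > 0"
    using assms(2) by (cases p) auto
  let ?F = "\<lambda>j. sign_corr (real_of_int c * real j / real p) (real_of_int a * real j / real (m * p))"
  let ?\<delta> = "\<lambda>r. real_of_int c * real r / real p"
  let ?x = "\<lambda>r. real_of_int a * real r / real (m * p)"
  \<comment> \<open>Passing from \<open>r\<close> to \<open>q p + r\<close> changes the lag by the
    integer \<open>c q\<close>, so the lag depends on \<open>r\<close> alone.\<close>
  have F: "?F (q * p + r) = sign_corr (?\<delta> r) (?x r + real_of_int a * real q / real m)" for q r
  proof -
    have "?\<delta> (q * p + r) = ?\<delta> r + of_int (c * int q)"
      "?x (q * p + r) = ?x r + real_of_int a * real q / real m"
      using p assms(1) by (simp_all add: field_simps)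
    moreover have "sign_corr (d + of_int k) y = sign_corr d y" for d y k
      using cos_turns_add_int[of "y + d" k] by (simp add: sign_corr_def add_ac)
    ultimately show ?thesis
      by (simp only:)
  qed
  have "(\<Sum>j<m * p. ?F j) = (\<Sum>q<m. \<Sum>j = q * p..<q * p + p. ?F j)"
    by (rule sum.nat_group[symmetric])
  also have "\<dots> = (\<Sum>q<m. \<Sum>r<p. ?F (q * p + r))"
    by (simp only: sum.atLeastLessThan_shift_0[of ?F] add_diff_cancel_left' atLeast0LessThan o_def)
  also have "\<dots> = (\<Sum>r<p. \<Sum>q<m. sign_corr (?\<delta> r) (?x r + real_of_int a * real q / real m))"
    unfolding F by (rule sum.swap)
  also have "\<dots> = (\<Sum>r<p. \<Sum>q<m. sign_corr (?\<delta> r) (?x r + real q / real m))"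
    using sign_corr_add_int assms(3)
    by (intro sum.cong refl sum_multiples_periodic) (simp_all add: add.assoc[symmetric])
  finally have S: "(\<Sum>j<m * p. ?F j)
      = (\<Sum>r<p. \<Sum>q<m. sign_corr (?\<delta> r) (?x r + real q / real m))" .
  have "(\<Sum>r<p. real m * mean_corr (?\<delta> r)) = real m * (\<Sum>r<p. mean_corr (?\<delta> r))"
    by (simp add: sum_distrib_left)
  also have "(\<Sum>r<p. mean_corr (?\<delta> r)) = 1 / real p"
    using sum_multiples_periodic[OF mean_corr_add_int assms(4)] sum_mean_corr[OF assms(2)] by simp
  finally have M: "(\<Sum>r<p. real m * mean_corr (?\<delta> r)) = real m / real p"
    by simp
  \<comment> \<open>A lag of half a turn would make the even number \<open>2 c r\<close> an odd
    multiple of the odd number \<open>p\<close>.\<close>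
  have nonhalf: "frac (?\<delta> r) \<noteq> 1/2" for r
  proof
    assume "frac (?\<delta> r) = 1/2"
    then have "2 * (real_of_int c * real r) = real p * (1 + 2 * of_int \<lfloor>?\<delta> r\<rfloor>)"
      using p by (simp add: frac_def field_simps)
    also have "\<dots> = real_of_int (int p * (1 + 2 * \<lfloor>?\<delta> r\<rfloor>))"
      by simp
    finally have "real_of_int (2 * (c * int r)) = real_of_int (int p * (1 + 2 * \<lfloor>?\<delta> r\<rfloor>))"
      by simp
    then have "2 * (c * int r) = int p * (1 + 2 * \<lfloor>?\<delta> r\<rfloor>)"
      by (simp only: of_int_eq_iff)
    then have "even (int p * (1 + 2 * \<lfloor>?\<delta> r\<rfloor>))"
      by (metis dvd_triv_left)
    then show False
      using assms(2) by simp
  qed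
  have "\<bar>(\<Sum>j<m * p. ?F j) - real m / real p\<bar>
      = \<bar>\<Sum>r<p. (\<Sum>q<m. sign_corr (?\<delta> r) (?x r + real q / real m)) - real m * mean_corr (?\<delta> r)\<bar>"
    unfolding S M[symmetric] by (simp only: sum_subtractf)
  also have "\<dots> \<le> (\<Sum>r<p. 8)"
    by (intro order.trans[OF sum_abs] sum_mono sum_sign_corr_bound assms(1) nonhalf)
  finally show ?thesis
    by simp
qed

theorem theorem2:
  "\<exists>C::real. \<forall>(n::nat) (p::nat) (a::int) (c::int).
     n > 0 \<and> \<not> prime n \<and> prime p \<and> p \<noteq> 2 \<and> p dvd n \<and> gcd a (int n) = 1 \<and>
     0 < \<bar>c\<bar> \<and> \<bar>c\<bar> \<le> int p - 1 \<longrightarrow>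
     \<bar>\<bar>\<Sum>j = 1..n.
         signum (cos (2 * pi * real_of_int a * real j / real n)) *
         signum (cos (2 * pi / real n * (real_of_int a + real_of_int c * real n / real p) * real j))\<bar>
       - real n / (real p)\<^sup>2\<bar> \<le> C * real p"
proof (intro exI[of _ 8] allI impI, elim conjE)
  fix n p :: nat and a c :: int
  assume n: "n > 0" and p: "prime p" "p \<noteq> 2" "p dvd n" and a: "gcd a (int n) = 1"
    and c: "0 < \<bar>c\<bar>" "\<bar>c\<bar> \<le> int p - 1"
  obtain m where m: "n = m * p"
    using p(3) by (metis dvd_def mult.commute)
  have pos: "m > 0" "p > 0"
    using n m by auto
  have "odd p"
    using p(1,2) primes_dvd_imp_eq two_is_prime_nat by blast
  have "coprime a (int m)"
    using a m by (simp add: coprime_iff_gcd_eq_1[symmetric])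
  have "\<not> int p dvd c"
    using c zdvd_imp_le[of "int p" "\<bar>c\<bar>"] by auto
  then have "coprime c (int p)"
    using p(1) by (simp add: coprime_commute[of c] prime_imp_coprime)
  let ?F = "\<lambda>j. sign_corr (real_of_int c * real j / real p) (real_of_int a * real j / real n)"
  have "signum (cos (2 * pi * real_of_int a * real j / real n)) *
      signum (cos (2 * pi / real n * (real_of_int a + real_of_int c * real n / real p) * real j))
      = ?F j" for j
  proof -
    have "2 * pi / real n * (real_of_int a + real_of_int c * real n / real p) * real j
        = 2 * pi * (real_of_int a * real j / real n + real_of_int c * real j / real p)"
      using n pos by (simp add: field_simps)
    then show ?thesis
      by (simp add: sign_corr_def mult.assoc)
  qed
  \<comment> \<open>The index ranges differ only in \<open>j = n\<close> against
    \<open>j = 0\<close>; at \<open>j = n\<close> both angles are whole numbers of turns, so these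
    terms agree.\<close>
  moreover have "(\<Sum>j = 1..n. ?F j) = (\<Sum>j<n. ?F j)"
  proof -
    have "?F n = ?F 0"
    proof -
      have "real_of_int c * real n / real p = of_int (c * int m)"
        "real_of_int a * real n / real n = of_int a"
        using n pos by (simp_all add: m)
      then show ?thesis
        using cos_turns_add_int[of 0 a] cos_turns_add_int[of 0 "a + c * int m"]
        by (simp add: sign_corr_def)
    qed
    moreover have "(\<Sum>j = 1..n. ?F j) = (\<Sum>j<n. ?F (Suc j))"
      by (simp add: sum.atLeast1_atMost_eq)
    moreover have "(\<Sum>j<n. ?F (Suc j)) - (\<Sum>j<n. ?F j) = ?F n - ?F 0"
      unfolding sum_subtractf[symmetric] by (rule sum_lessThan_telescope)
    ultimately show ?thesis
      by simp
  qed
  moreover have "\<bar>(\<Sum>j<n. ?F j) - real n / (real p)\<^sup>2\<bar> \<le> 8 * real p"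
    using correlation_sum_bound[OF pos(1) \<open>odd p\<close> \<open>coprime a (int m)\<close> \<open>coprime c (int p)\<close>] pos
    by (simp add: m power2_eq_square)
  \<comment> \<open>For a nonnegative main term \<open>M\<close>,
    \<open>\<bar>\<bar>S\<bar> - M\<bar> \<le> \<bar>S - M\<bar>\<close>, so the bound on the signed
    sum carries over to its absolute value.\<close>
  moreover have "real n / (real p)\<^sup>2 \<ge> 0"
    by simp
  ultimately show "\<bar>\<bar>\<Sum>j = 1..n.
         signum (cos (2 * pi * real_of_int a * real j / real n)) *
         signum (cos (2 * pi / real n * (real_of_int a + real_of_int c * real n / real p) * real j))\<bar>
       - real n / (real p)\<^sup>2\<bar> \<le> 8 * real p"
    by (simp only:)
qed

end
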